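(* Let $n\ge1$, and let $f,g_1,\dots,g_n$ be monotone functions on binary relations over a set $X$ with $f$ extensive and $g_1\supseteq g_2\supseteq\dots\supseteq g_n$. Suppose $f$ is $g_1$-compatible and, for some integers $m_i\ge1$, $f$ is $g_i^{m_i},g_{i+1}$-compatible for each $1\le i<n$. Then $f$ is $g_n$-sound via $f^\omega$: for every relation $\mathcal R$, $\mathcal R\subseteq g_n(f(\mathcal R))$ implies $f^\omega(\mathcal R)\subseteq g_n(f^\omega(\mathcal R))$.
   Context: Fix a set $X$. A function on relations is a map from the set of binary relations on $X$ to itself. For such functions, $(f\circ g)(\mathcal R)=f(g(\mathcal R))$, intersections and unions are pointwise, and $f\subseteq g$ means $f(\mathcal R)\subseteq g(\mathcal R)$ for all $\mathcal R$. $f^0=\mathrm{id}$, $f^{k+1}=f\circ f^k$, $f^\omega(\mathcal R)=\bigcup_{k\in\mathbb N}f^k(\mathcal R)$. $f$ is monotone if $\mathcal R\subseteq\mathcal S$ implies $f(\mathcal R)\subseteq f(\mathcal S)$; extensive (expansive) if $\mathrm{id}\subseteq f$. $f$ is $g$-compatible if $f\circ g\subseteq g\circ f$; $f$ is $g,h$-compatible if $f\circ(g\cap h)\subseteq h\circ f$. $f$ is $g$-sound via $f'$ if $f'$ is extensive and for every $\mathcal R$, $\mathcal R\subseteq g(f(\mathcal R))$ implies $f'(\mathcal R)\subseteq g(f'(\mathcal R))$. *)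

theory Defs
  imports "HOL-Library.FuncSet"
begin

(* A function on relations is an element of rels X \<rightarrow> rels X. Its values on relations
   that leave X \<times> X are unconstrained, so every property below is relativised to rels X. *)

definition rels :: "'a set \<Rightarrow> 'a rel set" where
  "rels X = Pow (X \<times> X)"

definition le_on :: "'a set \<Rightarrow> ('a rel \<Rightarrow> 'a rel) \<Rightarrow> ('a rel \<Rightarrow> 'a rel) \<Rightarrow> bool" where
  "le_on X f g \<longleftrightarrow> (\<forall>R \<in> rels X. f R \<subseteq> g R)"

definition extensive :: "'a set \<Rightarrow> ('a rel \<Rightarrow> 'a rel) \<Rightarrow> bool" where
  "extensive X f \<longleftrightarrow> le_on X id f"

definition omega :: "('a rel \<Rightarrow> 'a rel) \<Rightarrow> 'a rel \<Rightarrow> 'a rel" where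
  "omega f R = (\<Union>k. (f ^^ k) R)"

definition compatible :: "'a set \<Rightarrow> ('a rel \<Rightarrow> 'a rel) \<Rightarrow> ('a rel \<Rightarrow> 'a rel) \<Rightarrow> bool" where
  "compatible X f g \<longleftrightarrow> le_on X (f \<circ> g) (g \<circ> f)"

(* compatible2 X f g h: f is g,h-compatible; inf on functions is pointwise intersection. *)
definition compatible2 ::
    "'a set \<Rightarrow> ('a rel \<Rightarrow> 'a rel) \<Rightarrow> ('a rel \<Rightarrow> 'a rel) \<Rightarrow> ('a rel \<Rightarrow> 'a rel) \<Rightarrow> bool" where
  "compatible2 X f g h \<longleftrightarrow> le_on X (f \<circ> inf g h) (h \<circ> f)"

(* sound_via X f g f': f is g-sound via f'. *)
definition sound_via ::
    "'a set \<Rightarrow> ('a rel \<Rightarrow> 'a rel) \<Rightarrow> ('a rel \<Rightarrow> 'a rel) \<Rightarrow> ('a rel \<Rightarrow> 'a rel) \<Rightarrow> bool" where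
  "sound_via X f g f' \<longleftrightarrow>
     extensive X f' \<and> (\<forall>R \<in> rels X. R \<subseteq> g (f R) \<longrightarrow> f' R \<subseteq> g (f' R))"

end

theory Submission
  imports Defs
begin

text \<open>
  Put \<open>R\<^sub>k = f\<^sup>k R\<close>, an increasing chain with union \<open>f\<^sup>\<omega> R\<close>. By induction on \<open>i\<close>, every \<open>R\<^sub>k\<close> is
  contained in \<open>g\<^sub>i R\<^sub>j\<close> for some \<open>j\<close>. For \<open>i = 1\<close> this is \<open>g\<^sub>1\<close>-compatibility applied to
  \<open>R \<subseteq> g\<^sub>n (f R) \<subseteq> g\<^sub>1 (f R)\<close>. Passing from \<open>i\<close> to \<open>i + 1\<close>, iterating the hypothesis puts every
  \<open>R\<^sub>k\<close> inside some power \<open>g\<^sub>i^m\<^sub>i\<close> of a member of the chain, and a second induction, on \<open>k\<close>, applies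
  the \<open>g\<^sub>i^m\<^sub>i, g\<^sub>i\<^sub>+\<^sub>1\<close>-compatibility. At \<open>i = n\<close>, monotonicity of \<open>g\<^sub>n\<close> gives the claim for the union.
\<close>

text \<open>The index \<open>j\<close> may depend on \<open>k\<close> in any way: iterating
  \<open>h\<close> and taking maxima of indices destroy any fixed shift, and the union of the chain
  does not see the index.\<close>

definition chain_progresses :: "(nat \<Rightarrow> 'a rel) \<Rightarrow> ('a rel \<Rightarrow> 'a rel) \<Rightarrow> bool" where
  "chain_progresses C h \<longleftrightarrow> (\<forall>k. \<exists>j. C k \<subseteq> h (C j))"

lemma funpow_mem_rels:
  assumes "f \<in> rels X \<rightarrow> rels X" and "R \<in> rels X"
  shows "(f ^^ k) R \<in> rels X"
  by (induction k) (use assms in auto)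

lemma chain_progresses_funpow:
  assumes C: "\<And>k. C k \<in> rels X" and h: "h \<in> rels X \<rightarrow> rels X" and mono: "mono_on (rels X) h"
    and prog: "chain_progresses C h"
  shows "chain_progresses C (h ^^ m)"
proof (induction m)
  case 0
  then show ?case by (auto simp: chain_progresses_def)
next
  case (Suc m)
  have pow: "(h ^^ m) (C j) \<in> rels X" for j
    by (rule funpow_mem_rels[OF h C])
  show ?case
    unfolding chain_progresses_def
  proof
    fix k
    obtain j where j: "C k \<subseteq> h (C j)"
      using prog by (auto simp: chain_progresses_def)
    obtain l where "C j \<subseteq> (h ^^ m) (C l)"
      using Suc by (auto simp: chain_progresses_def)
    then have "h (C j) \<subseteq> h ((h ^^ m) (C l))"
      by (intro mono_onD[OF mono] C pow)
    with j show "\<exists>j. C k \<subseteq> (h ^^ Suc m) (C j)"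
      by auto
  qed
qed

lemma mono_on_rels_funpow:
  assumes "h \<in> rels X \<rightarrow> rels X" and "mono_on (rels X) h"
  shows "mono_on (rels X) (h ^^ m)"
proof (induction m)
  case 0
  then show ?case by (simp add: mono_on_def)
next
  case (Suc m)
  with assms(2) funpow_mem_rels[OF assms(1)] show ?case
    by (simp add: mono_on_def)
qed

lemma mono_funpow_extensive:
  assumes "f \<in> rels X \<rightarrow> rels X" and "extensive X f" and "R \<in> rels X"
  shows "mono (\<lambda>k. (f ^^ k) R)"
  unfolding mono_iff_le_Suc
  using funpow_mem_rels[OF assms(1,3)] assms(2) by (simp add: extensive_def le_on_def)

text \<open>Compatibility moves \<open>f\<close> under \<open>h\<close>, so each application of
  \<open>f\<close> to the starting inclusion raises both indices by one.\<close>

lemma chain_progresses_compatible: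
  assumes f: "f \<in> rels X \<rightarrow> rels X" and mono: "mono_on (rels X) f" and R: "R \<in> rels X"
    and h: "h \<in> rels X \<rightarrow> rels X"
    and comp: "compatible X f h" and start: "R \<subseteq> h (f R)"
  shows "chain_progresses (\<lambda>k. (f ^^ k) R) h"
proof -
  note C = funpow_mem_rels[OF f R]
  have "(f ^^ k) R \<subseteq> h ((f ^^ Suc k) R)" for k
  proof (induction k)
    case 0
    with start show ?case by simp
  next
    case (Suc k)
    have "f ((f ^^ k) R) \<subseteq> f (h ((f ^^ Suc k) R))"
      by (intro mono_onD[OF mono] C funcset_mem[OF h] Suc)
    also have "\<dots> \<subseteq> h (f ((f ^^ Suc k) R))"
      using comp C[of "Suc k"] by (simp add: compatible_def le_on_def)
    finally show ?case by simp
  qed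
  then show ?thesis
    unfolding chain_progresses_def by blast
qed

text \<open>Here \<open>p\<close> stands for the power of \<open>g i\<close> and \<open>h\<close>
  for \<open>g (i + 1)\<close>. Progress for \<open>p\<close> holds at every index; progress for
  \<open>h\<close> is gained one index at a time, since \<open>f\<close> can be moved under
  \<open>h\<close> only on the intersection of both.\<close>

lemma chain_progresses_compatible2:
  assumes f: "f \<in> rels X \<rightarrow> rels X" and mono_f: "mono_on (rels X) f"
    and ext: "extensive X f" and R: "R \<in> rels X"
    and mono_p: "mono_on (rels X) p"
    and h: "h \<in> rels X \<rightarrow> rels X" and mono_h: "mono_on (rels X) h"
    and comp: "compatible2 X f p h" and start: "R \<subseteq> h (f R)"
    and prog: "chain_progresses (\<lambda>k. (f ^^ k) R) p"
  shows "chain_progresses (\<lambda>k. (f ^^ k) R) h"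
proof -
  note C = funpow_mem_rels[OF f R]
  note incr = monoD[OF mono_funpow_extensive[OF f ext R]]
  have "\<exists>j. (f ^^ k) R \<subseteq> h ((f ^^ j) R)" for k
  proof (induction k)
    case 0
    from start have "(f ^^ 0) R \<subseteq> h ((f ^^ 1) R)" by simp
    then show ?case by blast
  next
    case (Suc k)
    then obtain i where i: "(f ^^ k) R \<subseteq> h ((f ^^ i) R)" by blast
    obtain j where j: "(f ^^ k) R \<subseteq> p ((f ^^ j) R)"
      using prog by (auto simp: chain_progresses_def)
    \<comment> \<open>The intersection needs one common argument. Extensivity makes the chain
      increasing, so both indices can be raised to their maximum.\<close>
    define l where "l = max i j"
    have "p ((f ^^ j) R) \<subseteq> p ((f ^^ l) R)"
      by (intro mono_onD[OF mono_p] C incr) (simp add: l_def)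
    moreover have "h ((f ^^ i) R) \<subseteq> h ((f ^^ l) R)"
      by (intro mono_onD[OF mono_h] C incr) (simp add: l_def)
    ultimately have "(f ^^ k) R \<subseteq> inf p h ((f ^^ l) R)"
      using i j by auto
    moreover have "inf p h ((f ^^ l) R) \<in> rels X"
      using funcset_mem[OF h C[of l]] by (auto simp: rels_def)
    ultimately have "f ((f ^^ k) R) \<subseteq> f (inf p h ((f ^^ l) R))"
      by (intro mono_onD[OF mono_f] C)
    also have "\<dots> \<subseteq> h (f ((f ^^ l) R))"
      using comp C[of l] by (simp add: compatible2_def le_on_def)
    finally have "(f ^^ Suc k) R \<subseteq> h ((f ^^ Suc l) R)" by simp
    then show ?case by blast
  qed
  then show ?thesis
    by (simp add: chain_progresses_def)
qed

lemma omega_mem_rels: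
  assumes "f \<in> rels X \<rightarrow> rels X" and "R \<in> rels X"
  shows "omega f R \<in> rels X"
  using funpow_mem_rels[OF assms] by (auto simp: omega_def rels_def)

lemma funpow_subset_omega: "(f ^^ k) R \<subseteq> omega f R"
  by (auto simp: omega_def)

lemma omega_subset_if_chain_progresses:
  assumes f: "f \<in> rels X \<rightarrow> rels X" and R: "R \<in> rels X" and mono: "mono_on (rels X) h"
    and prog: "chain_progresses (\<lambda>k. (f ^^ k) R) h"
  shows "omega f R \<subseteq> h (omega f R)"
proof -
  have "(f ^^ k) R \<subseteq> h (omega f R)" for k
  proof -
    obtain j where "(f ^^ k) R \<subseteq> h ((f ^^ j) R)"
      using prog by (auto simp: chain_progresses_def)
    also have "\<dots> \<subseteq> h (omega f R)"
      by (intro mono_onD[OF mono] funpow_mem_rels[OF f R] omega_mem_rels[OF f R] funpow_subset_omega)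
    finally show ?thesis .
  qed
  then show ?thesis
    by (subst omega_def) blast
qed

theorem theorem42:
  fixes X :: "'a set" and f :: "'a rel \<Rightarrow> 'a rel"
    and g :: "nat \<Rightarrow> 'a rel \<Rightarrow> 'a rel" and m :: "nat \<Rightarrow> nat" and n :: nat
  assumes "n \<ge> 1"
    and "f \<in> rels X \<rightarrow> rels X"
    and "\<And>i. 1 \<le> i \<Longrightarrow> i \<le> n \<Longrightarrow> g i \<in> rels X \<rightarrow> rels X"
    and "mono_on (rels X) f"
    and "\<And>i. 1 \<le> i \<Longrightarrow> i \<le> n \<Longrightarrow> mono_on (rels X) (g i)"
    and "extensive X f"
    and "\<And>i. 1 \<le> i \<Longrightarrow> i < n \<Longrightarrow> le_on X (g (i + 1)) (g i)"
    and "compatible X f (g 1)"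
    and "\<And>i. 1 \<le> i \<Longrightarrow> i < n \<Longrightarrow> m i \<ge> 1"
    and "\<And>i. 1 \<le> i \<Longrightarrow> i < n \<Longrightarrow> compatible2 X f (g i ^^ m i) (g (i + 1))"
  shows "sound_via X f (g n) (omega f)"
proof -
  \<comment> \<open>Downward induction from \<open>n\<close>; it turns the assumption on
    \<open>g n\<close> into a starting inclusion for every \<open>g i\<close>.\<close>
  have descending: "g n S \<subseteq> g i S" if "1 \<le> i" "i \<le> n" "S \<in> rels X" for i S
    using that(2,1)
  proof (induction rule: inc_induct)
    case base
    then show ?case by simp
  next
    case (step k)
    then show ?case
      using assms(7)[of k] that(3) by (fastforce simp: le_on_def)
  qed
  have "omega f R \<subseteq> g n (omega f R)" if R: "R \<in> rels X" and "R \<subseteq> g n (f R)" for R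
  proof -
    have start: "R \<subseteq> g i (f R)" if "1 \<le> i" "i \<le> n" for i
      using descending[OF that funcset_mem[OF assms(2) R]] \<open>R \<subseteq> g n (f R)\<close> by blast
    \<comment> \<open>The bound \<open>i \<le> n\<close> stays in the goal so that the upward
      induction from 1 carries it along.\<close>
    have "i \<le> n \<Longrightarrow> chain_progresses (\<lambda>k. (f ^^ k) R) (g i)" if "1 \<le> i" for i
      using that
    proof (induction i rule: dec_induct)
      case base
      show ?case
        using assms(1) start[of 1]
        by (intro chain_progresses_compatible[OF assms(2,4) R assms(3) assms(8)]) auto
    next
      case (step i)
      then have i: "1 \<le> i" "i < n" "1 \<le> i + 1" "i + 1 \<le> n" "i \<le> n" by auto
      have "chain_progresses (\<lambda>k. (f ^^ k) R) (g i ^^ m i)"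
        using step.IH i
        by (intro chain_progresses_funpow[OF funpow_mem_rels[OF assms(2) R] assms(3) assms(5)]) auto
      then have "chain_progresses (\<lambda>k. (f ^^ k) R) (g (i + 1))"
        by (rule chain_progresses_compatible2[OF assms(2,4,6) R
              mono_on_rels_funpow[OF assms(3)[OF i(1,5)] assms(5)[OF i(1,5)]]
              assms(3)[OF i(3,4)] assms(5)[OF i(3,4)] assms(10)[OF i(1,2)] start[OF i(3,4)]])
      then show ?case by simp
    qed
    then have "chain_progresses (\<lambda>k. (f ^^ k) R) (g n)"
      using assms(1) by blast
    then show ?thesis
      by (rule omega_subset_if_chain_progresses[OF assms(2) R assms(5)[OF assms(1) order_refl]])
  qed
  \<comment> \<open>The term with \<open>k = 0\<close> of the union is the relation itself.\<close>
  moreover have "extensive X (omega f)"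
    using funpow_subset_omega[of 0 f] by (simp add: extensive_def le_on_def)
  ultimately show ?thesis
    by (simp add: sound_via_def)
qed

end
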